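(* Let $D\subset\mathbb{R}^n$ be a domain, $T\in(0,\infty]$, and suppose $W:D\times[0,T)\to\mathbb{R}^n$ is a vector field transported by a family of diffeomorphisms $\{X(\cdot,t)\}_{t\in[0,T)}$ of $D$; write $W_0(x)=W(x,0)$. Let $\{\gamma_0(s)\}_{s\in I}$ be an integral curve of $W_0$. Then, for each $t\in[0,T)$, $s\mapsto\gamma(s,t):=X(\gamma_0(s),t)$ is an integral curve of $W(\cdot,t)$. Moreover, for all $s\in I$ and $t\in[0,T)$, $$\frac{|W(\gamma(s,t),t)|}{\left|\frac{\partial\gamma(s,t)}{\partial s}\right|}=\frac{|W_0(\gamma_0(s))|}{\left|\frac{\partial\gamma_0(s)}{\partial s}\right|}.$$
   Context: For every $t\in[0,T)$ the map $a\mapsto X(a,t)$ is a diffeomorphism of $D$ onto itself; $\nabla_aX(a,t)$ is its Jacobian matrix. Definition (transported). $W$ is transported by $X(\cdot,t)$ if $W(X(a,t),t)=\nabla_aX(a,t)\,W_0(a)$ for all $(a,t)\in D\times[0,T)$, where $W_0(x)=W(x,0)$. Integral curves are understood up to reparametrization: a differentiable curve $\{\gamma(s)\}_{s\in I}$ ($I\subset\mathbb{R}$ an interval) in $D$ with $\frac{\partial\gamma}{\partial s}(s)\neq0$ for all $s\in I$ is an integral curve of a vector field $V$ on $D$ if there is a function $f$ on $I$ with $f(s)\ne0$ and $\frac{\partial\gamma}{\partial s}(s)=f(s)V(\gamma(s))$ for all $s\in I$. *)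

theory Defs
  imports "HOL-Analysis.Analysis"
begin

text \<open>A differentiable bijection with differentiable inverse; this covers the \<open>C\<^sup>k\<close>
  diffeomorphisms for every \<open>k \<ge> 1\<close>.\<close>
definition diffeomorphism ::
    "'a::euclidean_space set \<Rightarrow> 'b::euclidean_space set \<Rightarrow> ('a \<Rightarrow> 'b) \<Rightarrow> bool" where
  "diffeomorphism D E f \<longleftrightarrow>
     bij_betw f D E \<and> f differentiable_on D \<and> inv_into D f differentiable_on E"

text \<open>The Jacobian matrix at a point around which \<open>f\<close> is defined; since \<open>D\<close> below is open, it does
  not depend on the values of \<open>f\<close> outside \<open>D\<close>.\<close>
definition jacobian_matrix ::
    "(real ^ 'n::finite \<Rightarrow> real ^ 'm::finite) \<Rightarrow> real ^ 'n \<Rightarrow> real ^ 'n ^ 'm" where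
  "jacobian_matrix f a = matrix (frechet_derivative f (at a))"

definition time_interval :: "ereal \<Rightarrow> real set" where
  "time_interval T = {t. 0 \<le> t \<and> ereal t < T}"

definition transported ::
    "(real ^ 'n::finite) set \<Rightarrow> ereal \<Rightarrow> (real ^ 'n \<Rightarrow> real \<Rightarrow> real ^ 'n) \<Rightarrow>
     (real ^ 'n \<Rightarrow> real \<Rightarrow> real ^ 'n) \<Rightarrow> bool" where
  "transported D T X W \<longleftrightarrow>
     (\<forall>a\<in>D. \<forall>t\<in>time_interval T. W (X a t) t = jacobian_matrix (\<lambda>x. X x t) a *v W a 0)"

text \<open>Integral curves up to reparametrization. The interval may contain its endpoints, where
  derivatives are one-sided, hence \<open>at s within I\<close>. It has to be non-degenerate: on a one-point
  set the derivative of a curve is not determined.\<close>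
definition integral_curve ::
    "(real ^ 'n::finite) set \<Rightarrow> (real ^ 'n \<Rightarrow> real ^ 'n) \<Rightarrow> real set \<Rightarrow> (real \<Rightarrow> real ^ 'n) \<Rightarrow> bool" where
  "integral_curve D V I \<gamma> \<longleftrightarrow>
     is_interval I \<and> interior I \<noteq> {} \<and> \<gamma> ` I \<subseteq> D \<and>
     (\<forall>s\<in>I. \<gamma> differentiable (at s within I) \<and> vector_derivative \<gamma> (at s within I) \<noteq> 0) \<and>
     (\<exists>f :: real \<Rightarrow> real. \<forall>s\<in>I. f s \<noteq> 0 \<and>
        vector_derivative \<gamma> (at s within I) = f s *\<^sub>R V (\<gamma> s))"

end

theory Submission imports Defs begin

text \<open>Write \<gamma>0' = f W0 along \<gamma>0. By the chain rule, the velocity of s \<mapsto>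
  X(\<gamma>0(s), t) is the Jacobian of X(., t) applied to f(s) W0(\<gamma>0(s)); by linearity and
  transport this equals f(s) W(X(\<gamma>0(s), t), t). So the same factor f serves at every time t,
  and both quotients equal 1/|f(s)|. The velocity stays nonzero because the derivative of a
  diffeomorphism is injective (\<open>diffeomorphism_derivative_eq_0_iff\<close>). Derivatives
  within I are unique because I has no isolated points
  (\<open>interval_at_within_neq_bot\<close>).\<close>

lemma interval_at_within_neq_bot:
  fixes I :: "real set"
  assumes "is_interval I" and "interior I \<noteq> {}" and "s \<in> I"
  shows "at s within I \<noteq> bot"
proof -
  have "I \<noteq> {s}"
    using assms(2) by auto
  moreover have "connected I"
    using assms(1) by (simp add: is_interval_connected)
  ultimately have "s islimpt I"
    using assms(3) connected_imp_perfect by blast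
  then show ?thesis
    by (simp add: trivial_limit_within)
qed

text \<open>Openness of D turns differentiability within D into differentiability at a, the form in
  which \<open>jacobian_matrix\<close> takes its derivative.\<close>

lemma diffeomorphism_has_derivative:
  assumes "open D" and "diffeomorphism D E f" and "a \<in> D"
  shows "(f has_derivative frechet_derivative f (at a)) (at a)"
proof -
  have "f differentiable at a within D"
    using assms by (simp add: diffeomorphism_def differentiable_on_def)
  then have "f differentiable at a"
    by (simp add: at_within_open[OF assms(3,1)])
  then show ?thesis
    by (simp add: frechet_derivative_works)
qed

text \<open>Differentiating the identity (inverse of f) o f = id at a gives the derivative of f a
  left inverse M, so its kernel is trivial.\<close>

lemma diffeomorphism_derivative_eq_0_iff:
  assumes "open D" and "diffeomorphism D E f" and "a \<in> D"
  shows "frechet_derivative f (at a) v = 0 \<longleftrightarrow> v = 0"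
proof -
  let ?L = "frechet_derivative f (at a)"
  have f: "(f has_derivative ?L) (at a within D)"
    by (rule has_derivative_at_withinI[OF diffeomorphism_has_derivative[OF assms]])
  have bij: "bij_betw f D E" and inv: "inv_into D f differentiable_on E"
    using assms(2) by (auto simp: diffeomorphism_def)
  have "f a \<in> E" and im: "f ` D = E"
    using bij assms(3) by (auto simp: bij_betw_def)
  then obtain M where M_deriv: "(inv_into D f has_derivative M) (at (f a) within f ` D)"
    using inv unfolding differentiable_on_def differentiable_def by blast
  from diff_chain_within[OF f M_deriv]
  have "(inv_into D f \<circ> f has_derivative M \<circ> ?L) (at a within D)" .
  \<comment> \<open>The composite is known to be the identity only on D, so it is replaced within D
    first; openness then gives the full derivative at a, which is unique.\<close>
  then have "((\<lambda>x. x) has_derivative M \<circ> ?L) (at a within D)"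
    by (rule has_derivative_transform[OF assms(3), rotated])
      (use bij in \<open>auto simp: bij_betw_def\<close>)
  then have "((\<lambda>x. x) has_derivative M \<circ> ?L) (at a)"
    by (simp add: at_within_open[OF assms(3,1)])
  then have M: "M \<circ> ?L = (\<lambda>x. x)"
    by (rule has_derivative_unique[OF _ has_derivative_ident])
  have "M 0 = 0"
    by (rule linear_0[OF has_derivative_linear[OF M_deriv]])
  moreover have "?L 0 = 0"
    by (rule linear_0[OF has_derivative_linear[OF f]])
  ultimately show ?thesis
    using M by (metis comp_apply)
qed

text \<open>Chain rule for a possibly one-sided inner derivative, as occurs at endpoints of I;
  linearity pulls h out of L (h v).\<close>

lemma has_vector_derivative_compose_has_derivative:
  assumes "(\<gamma> has_vector_derivative v) (at s within I)"
    and "(f has_derivative L) (at (\<gamma> s))"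
  shows "((\<lambda>s. f (\<gamma> s)) has_vector_derivative L v) (at s within I)"
proof -
  have "((\<lambda>s. f (\<gamma> s)) has_derivative (\<lambda>h. L (h *\<^sub>R v))) (at s within I)"
    by (rule has_derivative_compose[OF assms(1)[unfolded has_vector_derivative_def] assms(2)])
  moreover have "linear L"
    using assms(2) by (rule has_derivative_linear)
  ultimately show ?thesis
    by (simp add: has_vector_derivative_def linear_scale)
qed

theorem theorem1p2:
  fixes D :: "(real ^ 'n::finite) set"
    and T :: ereal
    and X W :: "real ^ 'n \<Rightarrow> real \<Rightarrow> real ^ 'n"
    and I :: "real set"
    and \<gamma>\<^sub>0 :: "real \<Rightarrow> real ^ 'n"
  assumes "open D" and "connected D" and "D \<noteq> {}"
    and "0 < T"
    and "\<And>t. t \<in> time_interval T \<Longrightarrow> diffeomorphism D D (\<lambda>a. X a t)"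
    and "transported D T X W"
    and "integral_curve D (\<lambda>x. W x 0) I \<gamma>\<^sub>0"
  shows "(\<forall>t\<in>time_interval T. integral_curve D (\<lambda>x. W x t) I (\<lambda>s. X (\<gamma>\<^sub>0 s) t)) \<and>
    (\<forall>s\<in>I. \<forall>t\<in>time_interval T.
       norm (W (X (\<gamma>\<^sub>0 s) t) t) / norm (vector_derivative (\<lambda>s. X (\<gamma>\<^sub>0 s) t) (at s within I))
       = norm (W (\<gamma>\<^sub>0 s) 0) / norm (vector_derivative \<gamma>\<^sub>0 (at s within I)))"
proof -
  note curve = assms(7)[unfolded integral_curve_def]
  obtain f where f: "\<And>s. s \<in> I \<Longrightarrow> f s \<noteq> 0"
    and f0: "\<And>s. s \<in> I \<Longrightarrow> vector_derivative \<gamma>\<^sub>0 (at s within I) = f s *\<^sub>R W (\<gamma>\<^sub>0 s) 0"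
    using curve by blast
  \<comment> \<open>The factor \<open>f\<close> is fixed before \<open>t\<close>, so it does not
    depend on time.\<close>
  have key: "(\<lambda>s. X (\<gamma>\<^sub>0 s) t) differentiable (at s within I)
      \<and> vector_derivative (\<lambda>s. X (\<gamma>\<^sub>0 s) t) (at s within I) = f s *\<^sub>R W (X (\<gamma>\<^sub>0 s) t) t
      \<and> W (X (\<gamma>\<^sub>0 s) t) t \<noteq> 0 \<and> W (\<gamma>\<^sub>0 s) 0 \<noteq> 0 \<and> X (\<gamma>\<^sub>0 s) t \<in> D"
    if s: "s \<in> I" and t: "t \<in> time_interval T" for s t
  proof -
    let ?a = "\<gamma>\<^sub>0 s"
    let ?L = "frechet_derivative (\<lambda>x. X x t) (at ?a)"
    have a: "?a \<in> D"
      using curve s by blast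
    have dX: "((\<lambda>x. X x t) has_derivative ?L) (at ?a)"
      using diffeomorphism_has_derivative[OF assms(1) assms(5)[OF t] a] .
    then have lin: "linear ?L"
      by (rule has_derivative_linear)
    \<comment> \<open>The transport hypothesis enters here; the matrix of the linear map
      \<open>?L\<close> acts as \<open>?L\<close> itself.\<close>
    have W: "W (X ?a t) t = ?L (W ?a 0)"
      using assms(6) a t lin by (simp add: transported_def jacobian_matrix_def matrix_works)
    have "(\<gamma>\<^sub>0 has_vector_derivative f s *\<^sub>R W ?a 0) (at s within I)"
      using curve s f0 vector_derivative_works by metis
    from has_vector_derivative_compose_has_derivative[OF this dX]
    have d: "((\<lambda>s. X (\<gamma>\<^sub>0 s) t) has_vector_derivative f s *\<^sub>R W (X ?a t) t) (at s within I)"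
      using lin W by (simp add: linear_scale)
    have "at s within I \<noteq> bot"
      using curve s interval_at_within_neq_bot by blast
    then have "vector_derivative (\<lambda>s. X (\<gamma>\<^sub>0 s) t) (at s within I) = f s *\<^sub>R W (X ?a t) t"
      using d by (rule vector_derivative_within)
    \<comment> \<open>Otherwise the velocity of the initial curve would vanish at s.\<close>
    moreover have "W ?a 0 \<noteq> 0"
      using curve s f0 by fastforce
    moreover from this have "W (X ?a t) t \<noteq> 0"
      using W diffeomorphism_derivative_eq_0_iff[OF assms(1) assms(5)[OF t] a] by simp
    moreover have "X ?a t \<in> D"
      using assms(5)[OF t] a by (auto simp: diffeomorphism_def bij_betw_def)
    ultimately show ?thesis
      using d differentiableI_vector by blast
  qed
  have "integral_curve D (\<lambda>x. W x t) I (\<lambda>s. X (\<gamma>\<^sub>0 s) t)" if t: "t \<in> time_interval T" for t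
    unfolding integral_curve_def
  proof (intro conjI)
    show "is_interval I" "interior I \<noteq> {}"
      using curve by blast+
    show "(\<lambda>s. X (\<gamma>\<^sub>0 s) t) ` I \<subseteq> D"
      using key t by blast
    show "\<forall>s\<in>I. (\<lambda>s. X (\<gamma>\<^sub>0 s) t) differentiable (at s within I) \<and>
        vector_derivative (\<lambda>s. X (\<gamma>\<^sub>0 s) t) (at s within I) \<noteq> 0"
      using key t f by simp
    show "\<exists>f. \<forall>s\<in>I. f s \<noteq> 0 \<and>
        vector_derivative (\<lambda>s. X (\<gamma>\<^sub>0 s) t) (at s within I) = f s *\<^sub>R W (X (\<gamma>\<^sub>0 s) t) t"
      using key t f by blast
  qed
  \<comment> \<open>Both quotients reduce to 1/|f s|. Cancelling the norms of W requires W to be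
    nonzero at both points, since 0/0 is 0 here; \<open>key\<close> provides this.\<close>
  then show ?thesis
    using key f f0 by simp
qed

end
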